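(* Let $p$ be a prime with $p\equiv 1\pmod 4$. Then $$\sum_{k=0}^{(p-1)/2}\frac{(1/2)_k^3}{k!^3}\equiv\frac{(1/2)_{(p-1)/4}^2}{\big(((p-1)/4)!\big)^2}\left\{1-\frac{p^2}{8}H_{(p-1)/4}^{(2)}\right\}\pmod{p^3}.$$
   Context: The shifted factorial is $(x)_0=1$ and $(x)_m=x(x+1)\cdots(x+m-1)$ for $m\ge1$. The harmonic numbers of order $2$ are $H_m^{(2)}=\sum_{k=1}^m \frac{1}{k^2}$. The congruence is between rational numbers whose denominators are prime to $p$, i.e. it is a congruence in the localization $\mathbb{Z}_{(p)}$ (equivalently, in the ring $\mathbb{Z}_p$ of $p$-adic integers). *)

theory Defs
  imports Complex_Main "HOL-Computational_Algebra.Primes" "HOL-Number_Theory.Cong"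
begin

text \<open>The localization of the integers at \<open>p\<close>, as a subset of the rationals. The function
  \<open>quotient_of\<close> returns numerator and denominator in lowest terms.\<close>

definition localization_at :: "nat \<Rightarrow> rat set" where
  "localization_at p = {x. coprime (snd (quotient_of x)) (int p)}"

text \<open>Congruence of two elements of the localization at \<open>p\<close> modulo the ideal generated by \<open>m\<close>.
  Membership of both sides in the localization is part of the relation.\<close>

definition local_cong :: "nat \<Rightarrow> rat \<Rightarrow> rat \<Rightarrow> nat \<Rightarrow> bool" where
  "local_cong p x y m \<longleftrightarrow>
     x \<in> localization_at p \<and> y \<in> localization_at p \<and>
     (\<exists>z \<in> localization_at p. x - y = of_nat m * z)"

definition harmonic2 :: "nat \<Rightarrow> rat" where
  "harmonic2 m = (\<Sum>k=1..m. 1 / of_nat k ^ 2)"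

end

theory Submission
  imports Defs
begin

text \<open>
  Put \<open>p = 4 m + 1\<close>, \<open>n = 2 m\<close>, \<open>t = p\<^sup>2 / 4\<close>, and write \<open>P\<^sub>k(s) = (1/2 - x)\<^sub>k (1/2 + x)\<^sub>k\<close> with
  \<open>s = x\<^sup>2\<close>. The sum in question is the value at \<open>s = 0\<close> of the polynomial
  \<open>F(s) = \<Sum>k\<le>n. (1/2)\<^sub>k / k!\<^sup>3 P\<^sub>k(s)\<close>. At \<open>s = t\<close> the parameters of the hypergeometric series become
  \<open>- n\<close>, \<open>n + 1\<close>, \<open>1/2\<close>, and Whipple's summation evaluates \<open>F(t)\<close> exactly as the leading factor
  \<open>G = (1/2)\<^sub>m\<^sup>2 / m!\<^sup>2\<close> of the right-hand side (\<open>whipple_sum_even\<close>). What is left is the increment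
  \<open>F(t) - F(0)\<close> modulo \<open>p\<^sup>3\<close>.

  As \<open>t\<close> is divisible by \<open>p\<^sup>2\<close>, the increment depends only on the coefficients of the
  \<open>P\<^sub>k\<close> in \<open>F\<close> modulo \<open>p\<close>. Modulo \<open>p\<close> one may replace \<open>(1/2)\<^sub>k / k!\<close> by \<open>(- n)\<^sub>k / (- 2 n)\<^sub>k\<close> (\<open>whipple_coeff_cong\<close>). For these
  coefficients Whipple's summation holds with \<open>s\<close> free, and gives a product of linear factors,
  \<open>Q(s) = \<Prod>i=1..n. ((2 i - 1/2)\<^sup>2 - s)\<close> divided by \<open>(2 n)!\<close> (\<open>terminating_sum_product\<close>). Hence, modulo
  \<open>p\<^sup>3\<close>, the increment is \<open>Q(t) - Q(0)\<close>, which is \<open>- p\<^sup>2 Q(0) \<Sum>i=1..n. 1 / (4 i - 1)\<^sup>2\<close>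
  (\<open>terminating_product_cong\<close>), where \<open>Q(0)\<close> matters only modulo \<open>p\<close> and may be replaced by \<open>G\<close>.

  The sum over \<open>i\<close> is \<open>- H\<^sub>m / 8\<close> modulo \<open>p\<close>, with \<open>H\<close> the harmonic numbers of order \<open>2\<close>
  (\<open>inverse_square_sum_cong\<close>); this rests on \<open>H\<^sub>2\<^sub>m\<close> being divisible by \<open>p\<close>. Thus
  \<open>F(0) = G - p\<^sup>2 / 8 H\<^sub>m G\<close> modulo \<open>p\<^sup>3\<close>.
\<close>

section \<open>Two hypergeometric identities\<close>

text \<open>This is \<open>(1/2 - x)\<^sub>k (1/2 + x)\<^sub>k\<close> as a polynomial in \<open>t = x\<^sup>2\<close>. The polynomials for
  \<open>k = 0, 1, \<dots>\<close> form a basis on which multiplication by \<open>t\<close> acts by a two-term recurrence.\<close>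

definition shifted_squares :: "rat \<Rightarrow> nat \<Rightarrow> rat" where
  "shifted_squares t k = (\<Prod>j<k. (of_nat j + 1/2)^2 - t)"

lemma shifted_squares_0 [simp]: "shifted_squares t 0 = 1"
  by (simp add: shifted_squares_def)

lemma shifted_squares_Suc:
  "shifted_squares t (Suc k) = shifted_squares t k * ((of_nat k + 1/2)^2 - t)"
  by (simp add: shifted_squares_def)

lemma shifted_squares_at_0: "shifted_squares 0 k = pochhammer (1/2) k ^ 2"
  by (induction k) (simp_all add: shifted_squares_Suc pochhammer_Suc power_mult_distrib add.commute)

lemma shifted_squares_eq_0:
  assumes "n < k"
  shows "shifted_squares ((of_nat n + 1/2)^2) k = 0"
  unfolding shifted_squares_def using assms by auto

definition whipple_coeff :: "nat \<Rightarrow> rat" where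
  "whipple_coeff k = pochhammer (1/2) k / fact k ^ 3"

lemma whipple_coeff_Suc:
  "of_nat (Suc k) ^ 3 * whipple_coeff (Suc k) = (of_nat k + 1/2) * whipple_coeff k"
proof -
  have "(of_nat (Suc k) :: rat) \<noteq> 0" by (simp del: of_nat_Suc)
  then show ?thesis
    by (simp add: whipple_coeff_def pochhammer_Suc power_mult_distrib field_simps del: of_nat_Suc)
qed

text \<open>The two products for \<open>t = (u + 3/2)\<^sup>2\<close> and \<open>t = (u - 1/2)\<^sup>2\<close> are \<open>(- 1 - u)\<^sub>k (u + 2)\<^sub>k\<close> and
  \<open>(1 - u)\<^sub>k (u)\<^sub>k\<close>. Both are, up to the constant \<open>u (u + 1)\<close>, the common product
  \<open>(- 1 - u)\<^sub>k (u)\<^sub>k\<close> times a quadratic in \<open>k\<close>. Stating the telescoping through that product avoids the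
  division by a shifted factorial that vanishes for integral \<open>u\<close>.\<close>

definition contiguous_product :: "rat \<Rightarrow> nat \<Rightarrow> rat" where
  "contiguous_product u k = (\<Prod>j<k. (of_nat j - 1 - u) * (of_nat j + u))"

lemma contiguous_product_Suc: "contiguous_product u (Suc k) = contiguous_product u k * ((of_nat k - 1 - u) * (of_nat k + u))"
  by (simp add: contiguous_product_def)

lemma contiguous_product_upper:
  "u * (u + 1) * shifted_squares ((u + 3/2)^2) k = contiguous_product u k * ((u + of_nat k) * (u + of_nat k + 1))"
proof (induction k)
  case 0
  show ?case by (simp add: contiguous_product_def)
next
  case (Suc k)
  have "u * (u + 1) * shifted_squares ((u + 3/2)^2) (Suc k)
      = (u * (u + 1) * shifted_squares ((u + 3/2)^2) k) * ((of_nat k + 1/2)^2 - (u + 3/2)^2)"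
    by (simp add: shifted_squares_Suc)
  also have "\<dots> = contiguous_product u (Suc k) * ((u + of_nat (Suc k)) * (u + of_nat (Suc k) + 1))"
    unfolding Suc contiguous_product_Suc by (simp add: field_simps power2_eq_square)
  finally show ?case .
qed

lemma contiguous_product_lower:
  "u * (u + 1) * shifted_squares ((u - 1/2)^2) k = contiguous_product u k * ((of_nat k - 1 - u) * (of_nat k - u))"
proof (induction k)
  case 0
  show ?case by (simp add: contiguous_product_def field_simps)
next
  case (Suc k)
  have "u * (u + 1) * shifted_squares ((u - 1/2)^2) (Suc k)
      = (u * (u + 1) * shifted_squares ((u - 1/2)^2) k) * ((of_nat k + 1/2)^2 - (u - 1/2)^2)"
    by (simp add: shifted_squares_Suc)
  also have "\<dots> = contiguous_product u (Suc k) * ((of_nat (Suc k) - 1 - u) * (of_nat (Suc k) - u))"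
    unfolding Suc contiguous_product_Suc by (simp add: field_simps power2_eq_square)
  finally show ?case .
qed

text \<open>Zeilberger's method for the recurrence \<open>(u + 1)\<^sup>2 f (u + 1) = u\<^sup>2 f (u - 1)\<close>, where \<open>f v\<close> is the
  sum for \<open>t = (v + 1/2)\<^sup>2\<close>. After cancelling the common product, the induction step is the polynomial
  identity
  \<open>(u + 1)\<^sup>2 (u + k) (u + k + 1) - u\<^sup>2 (k - 1 - u) (k - u)
    = - 2 (2 u + 1) ((k + 1/2) (k - 1 - u) (k + u) - k\<^sup>3)\<close>.\<close>

lemma whipple_telescope:
  "u * (u + 1) * ((u + 1)^2 * (\<Sum>k<K. whipple_coeff k * shifted_squares ((u + 3/2)^2) k)
      - u^2 * (\<Sum>k<K. whipple_coeff k * shifted_squares ((u - 1/2)^2) k))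
   = - 2 * (2 * u + 1) * (of_nat K ^ 3 * whipple_coeff K) * contiguous_product u K"
proof (induction K)
  case 0
  show ?case by simp
next
  case (Suc K)
  let ?U = "shifted_squares ((u + 3/2)^2)" and ?L = "shifted_squares ((u - 1/2)^2)"
  let ?c = "whipple_coeff" and ?k = "of_nat K :: rat"
  have "u * (u + 1) * ((u + 1)^2 * (\<Sum>k<Suc K. ?c k * ?U k) - u^2 * (\<Sum>k<Suc K. ?c k * ?L k))
     = u * (u + 1) * ((u + 1)^2 * (\<Sum>k<K. ?c k * ?U k) - u^2 * (\<Sum>k<K. ?c k * ?L k))
       + ?c K * ((u + 1)^2 * (u * (u + 1) * ?U K) - u^2 * (u * (u + 1) * ?L K))"
    by (simp add: algebra_simps)
  also have "\<dots> = - 2 * (2 * u + 1) * ((?k + 1/2) * ?c K)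
                    * (contiguous_product u K * ((?k - 1 - u) * (?k + u)))"
    unfolding Suc contiguous_product_upper contiguous_product_lower
    by (simp add: field_simps power2_eq_square power3_eq_cube)
  also have "\<dots> = - 2 * (2 * u + 1) * (of_nat (Suc K) ^ 3 * ?c (Suc K)) * contiguous_product u (Suc K)"
    unfolding whipple_coeff_Suc contiguous_product_Suc ..
  finally show ?case .
qed

text \<open>The case of Whipple's summation in which the series is
  \<open>\<^sub>3F\<^sub>2(- 2 m, 2 m + 1, 1/2; 1, 1; 1)\<close>. Once the sum runs past the point of termination the
  telescoped right-hand side vanishes, and the recurrence leads from \<open>m\<close> to \<open>m + 1\<close>.\<close>

lemma whipple_sum_even:
  assumes "2 * m < K"
  shows "(\<Sum>k<K. whipple_coeff k * shifted_squares ((2 * of_nat m + 1/2)^2) k)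
       = (pochhammer (1/2) m / fact m) ^ 2"
  using assms
proof (induction m arbitrary: K)
  case 0
  have z: "shifted_squares ((1/2)^2) k = 0" if "k > 0" for k
    using shifted_squares_eq_0[of 0 k] that by simp
  have "(\<Sum>k<K. whipple_coeff k * shifted_squares ((1/2)^2) k)
      = (\<Sum>k\<in>{0}. whipple_coeff k * shifted_squares ((1/2)^2) k)"
    using 0 z by (intro sum.mono_neutral_right) auto
  then show ?case by (simp add: whipple_coeff_def)
next
  case (Suc m)
  define u :: rat where "u = 2 * of_nat m + 1"
  have u: "u > 0" unfolding u_def by (simp add: add_nonneg_pos)
  have "contiguous_product u K = 0"
  proof -
    have "2 * m + 2 \<in> {..<K}" using Suc.prems by auto
    moreover have "(of_nat (2 * m + 2) - 1 - u) * (of_nat (2 * m + 2) + u) = 0" by (simp add: u_def)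
    ultimately show ?thesis unfolding contiguous_product_def by (intro prod_zero) (simp, blast)
  qed
  with whipple_telescope[of u K] u
  have step: "(u + 1)^2 * (\<Sum>k<K. whipple_coeff k * shifted_squares ((u + 3/2)^2) k)
      = u^2 * (\<Sum>k<K. whipple_coeff k * shifted_squares ((u - 1/2)^2) k)"
    by auto
  have "u - 1/2 = 2 * of_nat m + 1/2" "u + 3/2 = 2 * of_nat (Suc m) + 1/2"
    by (simp_all add: u_def)
  moreover have "(\<Sum>k<K. whipple_coeff k * shifted_squares ((2 * of_nat m + 1/2)^2) k)
      = (pochhammer (1/2) m / fact m) ^ 2"
    using Suc.prems by (intro Suc.IH) simp
  ultimately have "(u + 1)^2 * (\<Sum>k<K. whipple_coeff k * shifted_squares ((2 * of_nat (Suc m) + 1/2)^2) k)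
      = u^2 * (pochhammer (1/2) m / fact m) ^ 2"
    using step by (simp only:)
  also have "\<dots> = (u + 1)^2 * (pochhammer (1/2) (Suc m) / fact (Suc m)) ^ 2"
  proof -
    have u1: "u = 2 * (1/2 + of_nat m)" and u2: "u + 1 = 2 * of_nat (Suc m)" by (simp_all add: u_def)
    have "(of_nat (Suc m) :: rat) \<noteq> 0" by (simp del: of_nat_Suc)
    then have "u * (pochhammer (1/2) m / fact m) = (u + 1) * (pochhammer (1/2) (Suc m) / fact (Suc m))"
      unfolding u2 pochhammer_Suc fact_Suc by (subst u1) (simp add: mult_ac del: of_nat_Suc)
    then show ?thesis by (metis power_mult_distrib)
  qed
  finally show ?case using u by simp
qed

text \<open>Up to the factor \<open>(2 n)!\<close> this is \<open>(- n)\<^sub>k / (k!\<^sup>2 (- 2 n)\<^sub>k)\<close>, the coefficient of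
  \<open>\<^sub>3F\<^sub>2(1/2 - x, 1/2 + x, - n; 1, - 2 n; 1)\<close>. The scaling makes the sum below a monic
  polynomial up to sign.\<close>

definition terminating_coeff :: "nat \<Rightarrow> nat \<Rightarrow> rat" where
  "terminating_coeff n k = of_nat (n choose k) * fact (2 * n - k) / fact k"

lemma terminating_coeff_eq:
  assumes "k \<le> n"
  shows "terminating_coeff n k = fact n * fact (2 * n - k) / (fact k ^ 2 * fact (n - k))"
  using assms by (simp add: terminating_coeff_def binomial_fact power2_eq_square)

lemma terminating_coeff_rec_0: "terminating_coeff (Suc n) 0 = (2 * of_nat n + 1) * (2 * of_nat n + 2) * terminating_coeff n 0"
  by (simp add: terminating_coeff_def algebra_simps)

lemma terminating_coeff_rec_Suc:
  assumes "k \<le> n"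
  shows "terminating_coeff (Suc n) (Suc k)
    = (2 * of_nat n - of_nat k) * (2 * of_nat n + 3 + of_nat k) * terminating_coeff n (Suc k) + terminating_coeff n k"
proof (cases "k = n")
  case True
  have "2 * Suc n - Suc n = Suc n" "2 * n - n = n" by simp_all
  with True show ?thesis
    by (simp add: terminating_coeff_def del: mult_Suc_right)
next
  case False
  with assms obtain d where d: "n = Suc (k + d)"
    by (metis add_Suc_right le_neq_implies_less less_imp_Suc_add)
  have e: "2 * n - k = Suc (Suc (k + 2 * d))" "2 * n - Suc k = Suc (k + 2 * d)"
    "2 * Suc n - Suc k = Suc (Suc (Suc (k + 2 * d)))" "n - k = Suc d" "n - Suc k = d"
    "Suc n - Suc k = Suc d"
    using d by auto
  let ?K = "of_nat k :: rat" and ?D = "of_nat d :: rat"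
  define f g h :: rat where "f = fact k" and "g = fact d" and "h = fact (Suc (k + 2 * d))"
  define N :: rat where "N = fact n"
  have nz: "f \<noteq> 0" "g \<noteq> 0" "1 + ?D \<noteq> 0" "1 + ?K \<noteq> 0"
    unfolding f_def g_def by (simp_all add: of_nat_Suc [symmetric] del: of_nat_Suc)
  have "fact (Suc n) = (2 + ?K + ?D) * N"
    by (simp add: N_def d)
  moreover have "fact (2 * Suc n - Suc k) = (3 + ?K + 2 * ?D) * ((2 + ?K + 2 * ?D) * h)"
    unfolding e h_def fact_Suc[of "Suc (Suc _)"] fact_Suc[of "Suc (k + _)"] by (simp add: add.assoc)
  moreover have "fact (Suc k) = (1 + ?K) * f" "fact (Suc n - Suc k) = (1 + ?D) * g"
    by (simp_all add: f_def g_def e)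
  moreover have "Suc k \<le> Suc n" using assms by simp
  ultimately have 1: "terminating_coeff (Suc n) (Suc k)
      = (2 + ?K + ?D) * N * ((3 + ?K + 2 * ?D) * ((2 + ?K + 2 * ?D) * h)) / (((1 + ?K) * f)^2 * ((1 + ?D) * g))"
    by (simp only: terminating_coeff_eq)
  have 2: "terminating_coeff n (Suc k) = N * h / (((1 + ?K) * f)^2 * g)"
    using d unfolding f_def g_def h_def N_def by (simp add: terminating_coeff_eq e fact_Suc)
  have 3: "terminating_coeff n k = N * ((2 + ?K + 2 * ?D) * h) / (f^2 * ((1 + ?D) * g))"
    using d unfolding f_def g_def h_def N_def
    by (simp add: terminating_coeff_eq e fact_Suc)
  have 4: "(of_nat n :: rat) = 1 + ?K + ?D" using d by simp
  show ?thesis unfolding 1 2 3 4 using nz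
    by (simp add: divide_simps) (simp add: algebra_simps power2_eq_square)
qed

text \<open>Whipple's summation with third upper parameter \<open>- n\<close>, valid for every \<open>t\<close>. The factor that passes from \<open>n\<close> to
  \<open>n + 1\<close> is
  \<open>(2 n + 3/2)\<^sup>2 - t = (2 n + 1 - k) (2 n + 2 + k) + ((k + 1/2)\<^sup>2 - t)\<close>, and the last bracket turns
  the \<open>k\<close>-th basis polynomial into the next one. Comparing coefficients leaves exactly the two
  recurrences above.\<close>

lemma terminating_sum_product:
  "(\<Sum>k\<le>n. terminating_coeff n k * shifted_squares t k) = (\<Prod>i=1..n. (2 * of_nat i - 1/2)^2 - t)"
proof (induction n)
  case 0
  show ?case by (simp add: terminating_coeff_def)
next
  case (Suc n)
  let ?P = "shifted_squares t" and ?W = "terminating_coeff"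
  let ?a = "\<lambda>k. (2 * of_nat n + 1 - of_nat k) * (2 * of_nat n + 2 + of_nat k) :: rat"
  have split: "((2 * of_nat (Suc n) - 1/2)^2 - t) * ?P k = ?a k * ?P k + ?P (Suc k)" for k
    by (simp add: shifted_squares_Suc field_simps power2_eq_square)
  have "(\<Prod>i=1..Suc n. (2 * of_nat i - 1/2)^2 - t)
      = ((2 * of_nat (Suc n) - 1/2)^2 - t) * (\<Sum>k\<le>n. ?W n k * ?P k)"
    using Suc by simp
  also have "\<dots> = (\<Sum>k\<le>n. ?W n k * (?a k * ?P k + ?P (Suc k)))"
    unfolding split[symmetric] sum_distrib_left by (rule sum.cong) (simp_all add: mult_ac)
  also have "\<dots> = (\<Sum>k\<le>n. ?a k * ?W n k * ?P k) + (\<Sum>k\<le>n. ?W n k * ?P (Suc k))"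
    by (simp add: sum.distrib[symmetric] algebra_simps)
  also have "(\<Sum>k\<le>n. ?a k * ?W n k * ?P k) = (\<Sum>k\<le>Suc n. ?a k * ?W n k * ?P k)"
    by (simp add: terminating_coeff_def)
  also have "\<dots> = ?a 0 * ?W n 0 * ?P 0 + (\<Sum>k\<le>n. ?a (Suc k) * ?W n (Suc k) * ?P (Suc k))"
    by (rule sum.atMost_Suc_shift)
  also have "\<dots> + (\<Sum>k\<le>n. ?W n k * ?P (Suc k))
      = ?a 0 * ?W n 0 * ?P 0 + (\<Sum>k\<le>n. (?a (Suc k) * ?W n (Suc k) + ?W n k) * ?P (Suc k))"
    by (simp add: sum.distrib distrib_right)
  also have "\<dots> = ?W (Suc n) 0 * ?P 0 + (\<Sum>k\<le>n. ?W (Suc n) (Suc k) * ?P (Suc k))"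
    by (intro arg_cong2[where f = "(+)"] sum.cong)
       (simp_all add: terminating_coeff_rec_0 terminating_coeff_rec_Suc algebra_simps)
  also have "\<dots> = (\<Sum>k\<le>Suc n. ?W (Suc n) k * ?P k)"
    by (rule sum.atMost_Suc_shift[symmetric])
  finally show ?case ..
qed

section \<open>The adic filtration\<close>

text \<open>Arbitrary fractions with denominator prime to \<open>p\<close>, not only reduced ones, so that closure under
  the ring operations is seen from common denominators.\<close>

lemma localization_at_iff:
  "x \<in> localization_at p \<longleftrightarrow> (\<exists>a b. coprime b (int p) \<and> b \<noteq> 0 \<and> x = of_int a / of_int b)"
proof
  assume x: "x \<in> localization_at p"
  obtain n d where q: "quotient_of x = (n, d)" by fastforce
  have "x = of_int n / of_int d" "d > 0"
    using q quotient_of_div quotient_of_denom_pos by blast+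
  moreover have "coprime d (int p)" using x q by (simp add: localization_at_def)
  ultimately show "\<exists>a b. coprime b (int p) \<and> b \<noteq> 0 \<and> x = of_int a / of_int b" by force
next
  assume "\<exists>a b. coprime b (int p) \<and> b \<noteq> 0 \<and> x = of_int a / of_int b"
  then obtain a b where ab: "coprime b (int p)" "b \<noteq> 0" "x = of_int a / of_int b" by blast
  obtain n d where q: "quotient_of x = (n, d)" by fastforce
  have d: "x = of_int n / of_int d" "d > 0"
    using q quotient_of_div quotient_of_denom_pos by blast+
  with ab have "(of_int (n * b) :: rat) = of_int (a * d)" by (simp add: field_simps)
  then have "n * b = a * d" by (simp only: of_int_eq_iff)
  then have "d dvd n * b" by simp
  moreover have "coprime d n" using q quotient_of_coprime coprime_commute by blast
  ultimately have "d dvd b" by (simp add: coprime_dvd_mult_right_iff)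
  with ab(1) have "coprime d (int p)" by (meson coprime_divisors dvd_refl)
  then show "x \<in> localization_at p" using q by (simp add: localization_at_def)
qed

lemma localization_at_of_int [simp]: "of_int a \<in> localization_at p"
  unfolding localization_at_iff by (rule exI[of _ a], rule exI[of _ 1]) simp

lemma localization_at_of_nat [simp]: "of_nat a \<in> localization_at p"
  using localization_at_of_int[of "int a"] by simp

lemma localization_at_0 [simp]: "0 \<in> localization_at p"
  and localization_at_1 [simp]: "1 \<in> localization_at p"
  and localization_at_numeral [simp]: "numeral k \<in> localization_at p"
  using localization_at_of_nat[of 0] localization_at_of_nat[of 1] localization_at_of_nat[of "numeral k"]
  by simp_all

lemma localization_at_add [intro]:
  assumes "x \<in> localization_at p" "y \<in> localization_at p"
  shows "x + y \<in> localization_at p"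
proof -
  from assms obtain a b c d where ab: "coprime b (int p)" "b \<noteq> 0" "x = of_int a / of_int b"
    and cd: "coprime d (int p)" "d \<noteq> 0" "y = of_int c / of_int d"
    unfolding localization_at_iff by blast
  have "x + y = of_int (a * d + c * b) / of_int (b * d)"
    using ab(2,3) cd(2,3) by (simp add: field_simps)
  moreover have "coprime (b * d) (int p)" "b * d \<noteq> 0" using ab cd by simp_all
  ultimately show ?thesis unfolding localization_at_iff by blast
qed

lemma localization_at_mult [intro]:
  assumes "x \<in> localization_at p" "y \<in> localization_at p"
  shows "x * y \<in> localization_at p"
proof -
  from assms obtain a b c d where ab: "coprime b (int p)" "b \<noteq> 0" "x = of_int a / of_int b"
    and cd: "coprime d (int p)" "d \<noteq> 0" "y = of_int c / of_int d"
    unfolding localization_at_iff by blast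
  have "x * y = of_int (a * c) / of_int (b * d)"
    using ab(3) cd(3) by simp
  moreover have "coprime (b * d) (int p)" "b * d \<noteq> 0" using ab cd by simp_all
  ultimately show ?thesis unfolding localization_at_iff by blast
qed

lemma localization_at_uminus [intro]: "x \<in> localization_at p \<Longrightarrow> - x \<in> localization_at p"
  using localization_at_mult[OF localization_at_of_int, of x p "- 1"] by simp

lemma localization_at_diff [intro]:
  "x \<in> localization_at p \<Longrightarrow> y \<in> localization_at p \<Longrightarrow> x - y \<in> localization_at p"
  using localization_at_add[of x p "- y"] by auto

lemma localization_at_power [intro]: "x \<in> localization_at p \<Longrightarrow> x ^ n \<in> localization_at p"
  by (induction n) auto

lemma localization_at_sum [intro]:
  "(\<And>i. i \<in> A \<Longrightarrow> f i \<in> localization_at p) \<Longrightarrow> sum f A \<in> localization_at p"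
  by (induction A rule: infinite_finite_induct) auto

lemma localization_at_prod [intro]:
  "(\<And>i. i \<in> A \<Longrightarrow> f i \<in> localization_at p) \<Longrightarrow> prod f A \<in> localization_at p"
  by (induction A rule: infinite_finite_induct) auto

lemmas localization_at_closed = localization_at_add localization_at_mult localization_at_uminus
  localization_at_diff localization_at_power localization_at_sum localization_at_prod

lemma localization_at_inverse_int:
  assumes "prime p" "\<not> int p dvd b"
  shows "1 / of_int b \<in> localization_at p"
proof -
  have "coprime (int p) b" using assms by (simp add: prime_imp_coprime)
  then have "coprime b (int p)" by (simp add: coprime_commute)
  moreover have "b \<noteq> 0" using assms by auto
  ultimately show ?thesis unfolding localization_at_iff
    by (intro exI[of _ 1] exI[of _ b]) simp
qed

lemma localization_at_inverse_nat:
  assumes "prime p" "0 < k" "k < p"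
  shows "1 / of_nat k \<in> localization_at p"
  using localization_at_inverse_int[of p "int k"] assms nat_dvd_not_less[of k p] by simp

lemma localization_at_inverse_fact:
  assumes "prime p" "k < p"
  shows "1 / fact k \<in> localization_at p"
  using assms(2)
proof (induction k)
  case (Suc k)
  have "1 / fact (Suc k) = (1 / of_nat (Suc k)) * (1 / fact k :: rat)" by simp
  then show ?case using Suc localization_at_inverse_nat[OF assms(1), of "Suc k"]
    by (metis Suc_lessD localization_at_mult zero_less_Suc)
qed simp

text \<open>Congruence modulo \<open>p\<^sup>e\<close> is expressed as membership of a difference in this ideal, so that
  congruences of different strength can be multiplied: orders add.\<close>

definition adic_ideal :: "nat \<Rightarrow> nat \<Rightarrow> rat set" where
  "adic_ideal p e = (\<lambda>z. of_nat p ^ e * z) ` localization_at p"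

lemma adic_idealI: "z \<in> localization_at p \<Longrightarrow> x = of_nat p ^ e * z \<Longrightarrow> x \<in> adic_ideal p e"
  by (auto simp: adic_ideal_def)

lemma adic_ideal_0 [simp]: "adic_ideal p 0 = localization_at p"
  by (simp add: adic_ideal_def)

lemma zero_in_adic_ideal [simp]: "0 \<in> adic_ideal p e"
  by (rule adic_idealI[of 0]) simp_all

lemma adic_ideal_add: "x \<in> adic_ideal p e \<Longrightarrow> y \<in> adic_ideal p e \<Longrightarrow> x + y \<in> adic_ideal p e"
  by (auto simp: adic_ideal_def simp flip: distrib_left)

lemma adic_ideal_mult: "x \<in> adic_ideal p e \<Longrightarrow> y \<in> adic_ideal p f \<Longrightarrow> x * y \<in> adic_ideal p (e + f)"
  by (auto simp: adic_ideal_def power_add image_iff mult_ac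
      intro!: bexI[OF _ localization_at_mult])

lemma adic_ideal_scale: "x \<in> localization_at p \<Longrightarrow> y \<in> adic_ideal p e \<Longrightarrow> x * y \<in> adic_ideal p e"
  using adic_ideal_mult[of x p 0 y e] by simp

lemma adic_ideal_uminus: "x \<in> adic_ideal p e \<Longrightarrow> - x \<in> adic_ideal p e"
  using adic_ideal_scale[OF localization_at_of_int, of x p e "- 1"] by simp

lemma adic_ideal_diff: "x \<in> adic_ideal p e \<Longrightarrow> y \<in> adic_ideal p e \<Longrightarrow> x - y \<in> adic_ideal p e"
  using adic_ideal_add[OF _ adic_ideal_uminus, of x p e y] by simp

lemma adic_ideal_sum: "(\<And>i. i \<in> A \<Longrightarrow> f i \<in> adic_ideal p e) \<Longrightarrow> sum f A \<in> adic_ideal p e"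
  by (induction A rule: infinite_finite_induct) (auto intro: adic_ideal_add)

lemma adic_ideal_antimono: "e \<le> f \<Longrightarrow> x \<in> adic_ideal p f \<Longrightarrow> x \<in> adic_ideal p e"
  by (auto simp: adic_ideal_def image_iff le_iff_add power_add mult.assoc
      intro!: bexI[OF _ localization_at_mult] localization_at_power)

lemma adic_ideal_in_localization: "x \<in> adic_ideal p e \<Longrightarrow> x \<in> localization_at p"
  using adic_ideal_antimono[of 0 e x p] by simp

lemma adic_ideal_mult_cong:
  assumes "a - b \<in> adic_ideal p e" "c - d \<in> adic_ideal p e"
    and "a \<in> localization_at p" "d \<in> localization_at p"
  shows "a * c - b * d \<in> adic_ideal p e"
proof -
  have "a * c - b * d = a * (c - d) + d * (a - b)" by (simp add: algebra_simps)
  then show ?thesis using assms by (auto intro: adic_ideal_add adic_ideal_scale)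
qed

lemma inverse_square_cong:
  assumes "prime p" "\<not> int p dvd a" "\<not> int p dvd b" "int p dvd a - b"
  shows "1 / of_int a ^ 2 - 1 / of_int b ^ 2 \<in> adic_ideal p 1"
proof -
  from assms(4) obtain c where "a - b = int p * c" by (elim dvdE)
  then have "(of_int (a - b) :: rat) = of_int (int p * c)" by (simp only:)
  then have c: "of_int a - of_int b = (of_nat p * of_int c :: rat)" by simp
  have nz: "(of_int a :: rat) \<noteq> 0" "(of_int b :: rat) \<noteq> 0" using assms by auto
  let ?z = "- (of_int c * (of_int a + of_int b) * (1 / of_int a) ^ 2 * (1 / of_int b) ^ 2) :: rat"
  have "1 / of_int a ^ 2 - 1 / of_int b ^ 2
      = - ((of_int a - of_int b) * (of_int a + of_int b) * (1 / of_int a) ^ 2 * (1 / of_int b) ^ 2 :: rat)"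
    using nz by (simp add: field_simps power2_eq_square)
  then have "1 / of_int a ^ 2 - 1 / of_int b ^ 2 = of_nat p ^ 1 * ?z"
    unfolding c by (simp add: mult_ac)
  moreover have "?z \<in> localization_at p"
    using assms localization_at_inverse_int
    by (intro localization_at_uminus localization_at_mult localization_at_power localization_at_add) simp_all
  ultimately show ?thesis by (intro adic_idealI)
qed

text \<open>All terms of degree at least two in \<open>t\<close> lie in \<open>p\<^sup>2\<^sup>e\<close>, so only the linear one survives.\<close>

lemma prod_one_minus_cong:
  assumes "t \<in> adic_ideal p e" "finite A" "\<And>i. i \<in> A \<Longrightarrow> w i \<in> localization_at p"
  shows "(\<Prod>i\<in>A. 1 - t * w i) - (1 - t * (\<Sum>i\<in>A. w i)) \<in> adic_ideal p (e + e)"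
  using assms(2,3)
proof (induction A rule: finite_induct)
  case (insert i A)
  let ?Q = "\<Prod>i\<in>A. 1 - t * w i" and ?S = "\<Sum>i\<in>A. w i"
  have IH: "?Q - (1 - t * ?S) \<in> adic_ideal p (e + e)" using insert by auto
  have S: "?S \<in> localization_at p" using insert by auto
  have "t * ?S \<in> adic_ideal p e" using adic_ideal_scale[OF S assms(1)] by (simp add: mult.commute)
  moreover have "?Q - (1 - t * ?S) \<in> adic_ideal p e" using IH by (rule adic_ideal_antimono[rotated]) simp
  ultimately have "t * ?S - (?Q - (1 - t * ?S)) \<in> adic_ideal p e" by (rule adic_ideal_diff)
  then have "1 - ?Q \<in> adic_ideal p e" by simp
  then have "w i * (t * (1 - ?Q)) \<in> adic_ideal p (e + e)"
    using insert assms(1) by (intro adic_ideal_scale adic_ideal_mult) auto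
  with IH have "(?Q - (1 - t * ?S)) + w i * (t * (1 - ?Q)) \<in> adic_ideal p (e + e)"
    by (rule adic_ideal_add)
  also have "(?Q - (1 - t * ?S)) + w i * (t * (1 - ?Q)) = (1 - t * w i) * ?Q - (1 - t * (w i + ?S))"
    by (simp add: algebra_simps)
  finally show ?case using insert by simp
qed simp

section \<open>Harmonic sums\<close>

definition odd_harmonic2 :: "nat \<Rightarrow> rat" where
  "odd_harmonic2 n = (\<Sum>i=1..n. 1 / of_int (2 * int i - 1) ^ 2)"

lemma harmonic2_int: "harmonic2 n = (\<Sum>i=1..n. 1 / of_int (int i) ^ 2)"
  by (simp add: harmonic2_def)

lemma harmonic2_double: "harmonic2 (2 * n) = odd_harmonic2 n + harmonic2 n / 4"
proof (induction n)
  case (Suc n)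
  have "2 * Suc n = Suc (Suc (2 * n))" by simp
  then have "harmonic2 (2 * Suc n)
     = harmonic2 (2 * n) + 1 / of_nat (Suc (2 * n)) ^ 2 + 1 / of_nat (2 * Suc n) ^ 2"
    by (simp add: harmonic2_def)
  moreover have "odd_harmonic2 (Suc n) = odd_harmonic2 n + 1 / of_nat (Suc (2 * n)) ^ 2"
    by (simp add: odd_harmonic2_def)
  moreover have "harmonic2 (Suc n) / 4 = harmonic2 n / 4 + 1 / of_nat (2 * Suc n) ^ 2"
    by (simp only: of_nat_mult power_mult_distrib) (simp add: harmonic2_def add_divide_distrib)
  ultimately show ?case using Suc by simp
qed (simp add: harmonic2_def odd_harmonic2_def)

text \<open>The full sum \<open>H\<^sub>2\<^sub>n\<close> is computed modulo \<open>p = 2 n + 1\<close> in two ways. Folding \<open>i \<mapsto> p - i\<close> gives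
  \<open>2 H\<^sub>n\<close>. Separating even and odd terms, and folding the odd ones onto the even ones, gives
  \<open>H\<^sub>n / 4 + H\<^sub>n / 4\<close>. Hence \<open>3/2 H\<^sub>n\<close> vanishes modulo \<open>p\<close>.\<close>

lemma harmonic2_half_prime:
  assumes "prime p" "p = 2 * n + 1" "p > 3"
  shows "harmonic2 n \<in> adic_ideal p 1"
proof -
  have unit: "\<not> int p dvd int i" if "0 < i" "i < p" for i
    using that by (auto dest: dvd_imp_le)
  have "harmonic2 (n + n) = (\<Sum>i=1..n. 1 / of_int (int i) ^ 2) + (\<Sum>i=n+1..n+n. 1 / of_int (int i) ^ 2)"
    unfolding harmonic2_int by (rule sum.ub_add_nat) simp
  also have "(\<Sum>i=n+1..n+n. 1 / of_int (int i) ^ 2 :: rat) = (\<Sum>i=n+1..n+n. 1 / of_int (int p - int (n + n + 1 - i) ) ^ 2)"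
    using assms(2) by (intro sum.cong refl) (auto simp: of_nat_diff)
  also have "\<dots> = (\<Sum>i=1..n. 1 / of_int (int p - int i) ^ 2)"
    by (rule sum.reindex_bij_witness[of _ "\<lambda>i. n + n + 1 - i" "\<lambda>i. n + n + 1 - i"]) auto
  finally have "harmonic2 (n + n) - 2 * harmonic2 n
      = (\<Sum>i=1..n. 1 / of_int (int p - int i) ^ 2 - 1 / of_int (- int i) ^ 2)"
    by (simp add: sum_subtractf harmonic2_int)
  also have "\<dots> \<in> adic_ideal p 1"
  proof (intro adic_ideal_sum inverse_square_cong assms(1))
    fix i assume "i \<in> {1..n}"
    then have "\<not> int p dvd int i" using unit assms(2) by auto
    then show "\<not> int p dvd int p - int i" "\<not> int p dvd - int i"
      using dvd_diff_right_iff[of "int p" "int p" "int i"] by auto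
  qed simp
  finally have fold: "harmonic2 (n + n) - 2 * harmonic2 n \<in> adic_ideal p 1" .
  have "odd_harmonic2 n = (\<Sum>i=1..n. 1 / of_int (int p - int (2 * i)) ^ 2)"
    unfolding odd_harmonic2_def
  proof (intro sum.reindex_bij_witness[of _ "\<lambda>i. n + 1 - i" "\<lambda>i. n + 1 - i"])
    fix i assume "i \<in> {1..n}"
    then have "int p - int (2 * (n + 1 - i)) = 2 * int i - 1" using assms(2) by auto
    then show "1 / of_int (int p - int (2 * (n + 1 - i))) ^ 2 = (1 / of_int (2 * int i - 1) ^ 2 :: rat)"
      by (simp only:)
  qed auto
  moreover have "harmonic2 n / 4 = (\<Sum>i=1..n. 1 / of_int (- int (2 * i)) ^ 2)"
    by (simp add: harmonic2_def sum_divide_distrib power_mult_distrib mult.commute)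
  ultimately have "odd_harmonic2 n - harmonic2 n / 4
      = (\<Sum>i=1..n. 1 / of_int (int p - int (2 * i)) ^ 2 - 1 / of_int (- int (2 * i)) ^ 2)"
    by (simp add: sum_subtractf)
  also have "\<dots> \<in> adic_ideal p 1"
  proof (intro adic_ideal_sum inverse_square_cong assms(1))
    fix i assume "i \<in> {1..n}"
    then have "\<not> int p dvd int (2 * i)" using assms(2) by (intro unit) auto
    then show "\<not> int p dvd int p - int (2 * i)" "\<not> int p dvd - int (2 * i)"
      using dvd_diff_right_iff[of "int p" "int p" "int (2 * i)"] by auto
  qed simp
  finally have "odd_harmonic2 n - harmonic2 n / 4 \<in> adic_ideal p 1" .
  from adic_ideal_diff[OF this fold]
  have "(odd_harmonic2 n - harmonic2 n / 4) - (harmonic2 (n + n) - 2 * harmonic2 n) \<in> adic_ideal p 1" .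
  also have "(odd_harmonic2 n - harmonic2 n / 4) - (harmonic2 (n + n) - 2 * harmonic2 n) = 3/2 * harmonic2 n"
    unfolding mult_2[symmetric, of n] harmonic2_double by simp
  finally have "3/2 * harmonic2 n \<in> adic_ideal p 1" .
  moreover have "2 * (1 / of_nat 3) \<in> localization_at p"
    using assms by (intro localization_at_mult localization_at_inverse_nat) simp_all
  ultimately have "2 * (1 / of_nat 3) * (3/2 * harmonic2 n) \<in> adic_ideal p 1" by (rule adic_ideal_scale[rotated])
  then show ?thesis by simp
qed

text \<open>In this range \<open>4 i - 1\<close> is less than \<open>2 p\<close>, and it differs from \<open>p\<close> modulo \<open>4\<close>.\<close>

lemma not_dvd_four_i_minus_one:
  assumes "p = 4 * m + 1" "i \<in> {1..2 * m}"
  shows "\<not> int p dvd 4 * int i - 1"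
proof
  assume "int p dvd 4 * int i - 1"
  then obtain q where q: "4 * int i - 1 = int p * q" by (elim dvdE)
  have "0 < int p * q" "int p * q < int p * 2" using q assms by auto
  then have "0 < q" "q < 2"
    using assms(1) mult_less_cancel_left_pos[of "int p" q 2] by (simp_all add: zero_less_mult_iff del: of_nat_Suc)
  then have "q = 1" by simp
  with q assms(1) have "4 * int i - 1 = 4 * int m + 1" by simp
  then show False by presburger
qed

text \<open>Modulo \<open>p\<close>, \<open>4 i - 1\<close> is \<open>4 i - 1 - p = 2 (2 (i - m) - 1)\<close>, which runs through twice the odd
  numbers between \<open>- 2 m\<close> and \<open>2 m\<close>. The sum is therefore half of the odd part \<open>H\<^sub>2\<^sub>m - H\<^sub>m / 4\<close>
  of \<open>H\<^sub>2\<^sub>m\<close>, and \<open>H\<^sub>2\<^sub>m\<close> vanishes modulo \<open>p\<close>.\<close>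

lemma inverse_square_sum_cong:
  assumes "prime p" "p = 4 * m + 1"
  shows "(\<Sum>i=1..2*m. 1 / of_int (4 * int i - 1) ^ 2) + harmonic2 m / 8 \<in> adic_ideal p 1"
proof -
  let ?f = "\<lambda>i. 1 / of_int (2 * int i - 2 * int m - 1) ^ 2 :: rat"
  have p: "p > 3" using assms prime_gt_1_nat[of p] by simp
  have "(\<Sum>i=1..m+m. ?f i) = (\<Sum>i=1..m. ?f i) + (\<Sum>i=m+1..m+m. ?f i)"
    by (rule sum.ub_add_nat) simp
  also have "(\<Sum>i=m+1..m+m. ?f i) = odd_harmonic2 m"
    unfolding odd_harmonic2_def
    by (rule sum.reindex_bij_witness[of _ "\<lambda>i. i + m" "\<lambda>i. i - m"]) (auto simp: of_nat_diff)
  also have "(\<Sum>i=1..m. ?f i) = odd_harmonic2 m"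
    unfolding odd_harmonic2_def
  proof (intro sum.reindex_bij_witness[of _ "\<lambda>i. m + 1 - i" "\<lambda>i. m + 1 - i"])
    fix i assume "i \<in> {1..m}"
    then have "2 * int (m + 1 - i) - 1 = - (2 * int i - 2 * int m - 1)" by auto
    then show "1 / of_int (2 * int (m + 1 - i) - 1) ^ 2 = ?f i"
      by (simp only: of_int_minus power2_minus)
  qed auto
  finally have f: "(\<Sum>i=1..2*m. ?f i) = 2 * odd_harmonic2 m" unfolding mult_2 .
  have g: "?f i / 4 = 1 / of_int (4 * int i - 1 - int p) ^ 2" for i
  proof -
    have "4 * int i - 1 - int p = 2 * (2 * int i - 2 * int m - 1)" using assms(2) by simp
    then show ?thesis by (simp only: of_int_mult power_mult_distrib) simp
  qed
  have "(\<Sum>i=1..2*m. 1 / of_int (4 * int i - 1) ^ 2) - odd_harmonic2 m / 2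
      = (\<Sum>i=1..2*m. 1 / of_int (4 * int i - 1) ^ 2) - (\<Sum>i=1..2*m. ?f i / 4)"
    unfolding sum_divide_distrib[symmetric] f by simp
  also have "\<dots> = (\<Sum>i=1..2*m. 1 / of_int (4 * int i - 1) ^ 2 - 1 / of_int (4 * int i - 1 - int p) ^ 2)"
    unfolding g by (rule sum_subtractf[symmetric])
  also have "\<dots> \<in> adic_ideal p 1"
  proof (intro adic_ideal_sum inverse_square_cong assms(1))
    fix i assume "i \<in> {1..2*m}"
    with assms show "\<not> int p dvd 4 * int i - 1" by (intro not_dvd_four_i_minus_one)
    then show "\<not> int p dvd 4 * int i - 1 - int p"
      using dvd_diff_left_iff[of "int p" "int p" "4 * int i - 1"] by simp
  qed simp
  finally have 1: "(\<Sum>i=1..2*m. 1 / of_int (4 * int i - 1) ^ 2) - odd_harmonic2 m / 2 \<in> adic_ideal p 1" .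
  have 2: "1 / of_nat 2 * harmonic2 (2 * m) \<in> adic_ideal p 1"
    using assms p by (intro adic_ideal_scale localization_at_inverse_nat harmonic2_half_prime) simp_all
  have "x - y / 2 + 1 / of_nat 2 * (y + h / 4) = x + h / 8" for x y h :: rat
    by (simp add: field_simps)
  with adic_ideal_add[OF 1 2] show ?thesis unfolding harmonic2_double by (simp only:)
qed

section \<open>The congruence\<close>

lemma pochhammer_half_in_localization:
  assumes "prime p" "odd p"
  shows "pochhammer (1/2) k \<in> localization_at p"
proof -
  have "p > 2" using assms prime_ge_2_nat[of p] by (cases "p = 2") auto
  then have "1/2 \<in> localization_at p" using localization_at_inverse_nat[of p 2] assms by simp
  then show ?thesis unfolding pochhammer_prod
    by (intro localization_at_closed) simp_all
qed

text \<open>With \<open>p = 2 n + 1\<close> the residues of \<open>- n\<close> and \<open>- 2 n\<close> modulo \<open>p\<close> are \<open>1/2\<close> and \<open>1\<close>, so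
  \<open>(- n)\<^sub>k / (- 2 n)\<^sub>k\<close> is congruent to \<open>(1/2)\<^sub>k / k!\<close>. The denominators stay units as long as
  \<open>k \<le> n\<close>, because \<open>2 n - j\<close> lies strictly between \<open>0\<close> and \<open>p\<close> for \<open>j < k\<close>.\<close>

lemma whipple_coeff_cong:
  assumes "prime p" "p = 2 * n + 1" "k \<le> n"
  shows "whipple_coeff k - terminating_coeff n k / fact (2 * n) \<in> adic_ideal p 1"
proof -
  define a where "a k = (pochhammer (1/2) k / fact k :: rat)" for k
  define b where "b k = (fact n * fact (2 * n - k) / (fact (n - k) * fact (2 * n)) :: rat)" for k
  have ab: "a k \<in> localization_at p \<and> b k \<in> localization_at p \<and> a k - b k \<in> adic_ideal p 1"
    if "k \<le> n" for k
    using that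
  proof (induction k)
    case 0
    then show ?case by (simp add: a_def b_def)
  next
    case (Suc k)
    define K N :: rat where "K = of_nat k" and "N = of_nat n"
    \<comment> \<open>The ratios \<open>a (Suc k) / a k\<close> and \<open>b (Suc k) / b k\<close>; their difference has numerator
      \<open>(2 k + 1) (2 n - k) - 2 (k + 1) (n - k) = k (2 n + 1) = k p\<close>.\<close>
    define r s where "r = (2 * K + 1) * (1 / of_nat (2 * Suc k))"
      and "s = (N - K) * (1 / of_nat (2 * n - k))"
    have bounds: "0 < 2 * Suc k" "2 * Suc k < p" "0 < 2 * n - k" "2 * n - k < p"
      using Suc.prems assms(2) by auto
    note inv = localization_at_inverse_nat[OF assms(1) bounds(1,2)]
      localization_at_inverse_nat[OF assms(1) bounds(3,4)]
    have rL: "r \<in> localization_at p" and sL: "s \<in> localization_at p"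
      unfolding r_def s_def K_def N_def
      by (intro localization_at_closed inv localization_at_of_nat localization_at_numeral localization_at_1)+
    have d: "of_nat (2 * Suc k) = 2 * (K + 1)" "of_nat (2 * n - k) = 2 * N - K"
      using Suc.prems by (simp_all add: K_def N_def of_nat_diff)
    have nz: "K + 1 \<noteq> 0" "2 * N - K \<noteq> 0"
      using Suc.prems unfolding d(2)[symmetric] by (simp_all add: K_def of_nat_Suc[symmetric] add.commute del: of_nat_Suc of_nat_mult)
    have "r - s = of_nat p ^ 1 * (K * ((1 / of_nat (2 * Suc k)) * (1 / of_nat (2 * n - k))))"
      unfolding r_def s_def d using nz assms(2)
      by (simp add: N_def[symmetric] divide_simps) (simp add: algebra_simps)
    moreover have "K * ((1 / of_nat (2 * Suc k)) * (1 / of_nat (2 * n - k))) \<in> localization_at p"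
      unfolding K_def by (intro localization_at_mult inv localization_at_of_nat)
    ultimately have rs: "r - s \<in> adic_ideal p 1" by (rule adic_idealI[rotated])
    have ra: "a (Suc k) = a k * r"
    proof -
      have "K + 1/2 = (2 * K + 1) / 2" by simp
      then show ?thesis using nz unfolding a_def r_def d
        by (simp add: pochhammer_Suc K_def[symmetric] add.commute field_simps)
    qed
    have sb: "b (Suc k) = b k * s"
    proof -
      have "n - k = Suc (n - Suc k)" "2 * n - k = Suc (2 * n - Suc k)" using Suc.prems by auto
      then have "fact (n - k) = of_nat (n - k) * (fact (n - Suc k) :: rat)"
        "fact (2 * n - k) = of_nat (2 * n - k) * (fact (2 * n - Suc k) :: rat)"
        by (metis fact_Suc of_nat_fact)+
      moreover have "of_nat (n - k) = N - K" using Suc.prems by (simp add: K_def N_def of_nat_diff)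
      ultimately have f: "fact (n - k) = (N - K) * (fact (n - Suc k) :: rat)"
        "fact (2 * n - k) = (2 * N - K) * (fact (2 * n - Suc k) :: rat)"
        unfolding d by simp_all
      have "x * (y * g) / (z * h * w) * (z * (1 / y)) = x * g / (h * w)"
        if "y \<noteq> 0" "z \<noteq> 0" for x y z g h w :: rat
        using that by simp
      moreover have "N - K \<noteq> 0" using Suc.prems by (simp add: K_def N_def)
      ultimately show ?thesis using nz(2) unfolding b_def s_def d f by simp
    qed
    show ?case using Suc rL sL rs unfolding ra sb
      by (auto intro: adic_ideal_mult_cong)
  qed
  have "whipple_coeff k - terminating_coeff n k / fact (2 * n) = (1 / fact k) ^ 2 * (a k - b k)"
    using assms(3)
    by (simp add: whipple_coeff_def terminating_coeff_eq a_def b_def power2_eq_square power3_eq_cube field_simps)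
  also have "\<dots> \<in> adic_ideal p 1"
    using ab[OF assms(3)] assms
    by (intro adic_ideal_scale localization_at_power localization_at_inverse_fact) auto
  finally show ?thesis .
qed

lemma shifted_squares_cong:
  assumes "prime p" "odd p" "t \<in> adic_ideal p e"
  shows "shifted_squares t k \<in> localization_at p"
    and "shifted_squares t k - shifted_squares 0 k \<in> adic_ideal p e"
proof -
  have "1/2 \<in> localization_at p" using pochhammer_half_in_localization[OF assms(1,2), of 1] by simp
  then have L: "(of_nat j + 1/2)^2 - s \<in> localization_at p" if "s \<in> localization_at p" for s j
    using that by (intro localization_at_closed) simp_all
  have t: "t \<in> localization_at p" using assms(3) by (rule adic_ideal_in_localization)
  have S: "shifted_squares s k \<in> localization_at p" if "s \<in> localization_at p" for s k
    unfolding shifted_squares_def using L that by blast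
  show "shifted_squares t k \<in> localization_at p" using S t .
  show "shifted_squares t k - shifted_squares 0 k \<in> adic_ideal p e"
  proof (induction k)
    case (Suc k)
    have "((of_nat k + 1/2)^2 - t) - ((of_nat k + 1/2)^2 - 0) \<in> adic_ideal p e"
      using adic_ideal_uminus[OF assms(3)] by simp
    with Suc show ?case unfolding shifted_squares_Suc
      using S[OF t] L[OF localization_at_0] by (intro adic_ideal_mult_cong)
  qed simp
qed

text \<open>The \<open>i\<close>-th factor at \<open>t = p\<^sup>2 / 4\<close> is its value at \<open>0\<close> times \<open>1 - p\<^sup>2 / (4 i - 1)\<^sup>2\<close>. The
  error made in keeping only the linear terms of the product of these is of order \<open>p\<^sup>4\<close>, since every
  \<open>4 i - 1\<close> is a unit.\<close>

lemma terminating_product_cong: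
  assumes "prime p" "p = 4 * m + 1" "n = 2 * m" "t = of_nat p ^ 2 / 4"
  defines "Q \<equiv> \<lambda>t. (\<Prod>i=1..n. (2 * of_nat i - 1/2)^2 - t) / (fact (2 * n) :: rat)"
  shows "Q t - Q 0 * (1 - of_nat p ^ 2 * (\<Sum>i=1..n. 1 / of_int (4 * int i - 1) ^ 2)) \<in> adic_ideal p 3"
proof -
  let ?w = "\<lambda>i. (1 / of_int (4 * int i - 1)) ^ 2 :: rat"
  let ?s = "of_nat p ^ 2 :: rat"
  have half: "1 / of_nat 4 \<in> localization_at p"
    using assms(1,2) prime_gt_1_nat[of p] by (intro localization_at_inverse_nat) auto
  have factor: "(2 * of_nat i - 1/2)^2 - t = (2 * of_nat i - 1/2)^2 * (1 - ?s * ?w i)"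
    if "i \<in> {1..n}" for i
  proof -
    have "4 * int i - 1 \<noteq> 0" by presburger
    then have "(of_int (4 * int i - 1) :: rat) \<noteq> 0" by (simp only: of_int_eq_0_iff not_False_eq_True)
    moreover have "2 * of_nat i - 1/2 = of_int (4 * int i - 1) / (2 :: rat)" by simp
    ultimately show ?thesis unfolding assms(4)
      by (simp only:) (simp add: power_divide right_diff_distrib del: of_int_diff of_int_mult)
  qed
  have Q: "Q t = Q 0 * (\<Prod>i=1..n. 1 - ?s * ?w i)"
    unfolding Q_def using factor by (simp add: prod.distrib)
  have "?s \<in> adic_ideal p 2" by (rule adic_idealI[of 1]) simp_all
  then have "(\<Prod>i=1..n. 1 - ?s * ?w i) - (1 - ?s * (\<Sum>i=1..n. ?w i)) \<in> adic_ideal p (2 + 2)"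
    using not_dvd_four_i_minus_one assms
    by (intro prod_one_minus_cong localization_at_power localization_at_inverse_int) auto
  then have *: "(\<Prod>i=1..n. 1 - ?s * ?w i) - (1 - ?s * (\<Sum>i=1..n. ?w i)) \<in> adic_ideal p 3"
    by (rule adic_ideal_antimono[rotated]) simp
  have "Q 0 \<in> localization_at p"
  proof -
    have root: "(2 * of_nat i - 1/2)^2 - 0 \<in> localization_at p" for i
    proof -
      have "(2 * of_nat i - 2 * (1 / of_nat 4))^2 - 0 \<in> localization_at p"
        using half by (intro localization_at_closed) simp_all
      then show ?thesis by simp
    qed
    have "(\<Prod>i=1..n. (2 * of_nat i - 1/2)^2 - 0) * (1 / fact (2 * n)) \<in> localization_at p"
      by (rule localization_at_mult[OF localization_at_prod[OF root] localization_at_inverse_fact])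
         (use assms(1-3) in simp_all)
    then show ?thesis by (simp add: Q_def)
  qed
  from adic_ideal_scale[OF this *]
  show ?thesis unfolding Q by (simp add: right_diff_distrib power_divide)
qed

theorem corollary1p2:
  fixes p :: nat
  assumes "prime p" and "[p = 1] (mod 4)"
  shows "local_cong p
    (\<Sum>k=0..(p - 1) div 2. pochhammer (1/2) k ^ 3 / fact k ^ 3)
    (pochhammer (1/2) ((p - 1) div 4) ^ 2 / fact ((p - 1) div 4) ^ 2
      * (1 - of_nat p ^ 2 / 8 * harmonic2 ((p - 1) div 4)))
    (p ^ 3)"
proof -
  define m where "m = (p - 1) div 4"
  define n where "n = 2 * m"
  have "p mod 4 = 1" using assms(2) by (simp add: cong_def)
  then have p: "p = 4 * m + 1" unfolding m_def by presburger
  have pn: "p = 2 * n + 1" and half: "(p - 1) div 2 = n" using p by (simp_all add: n_def)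
  have "odd p" using p by simp
  define t :: rat where "t = of_nat p ^ 2 / 4"
  define F where "F s = (\<Sum>k\<le>n. whipple_coeff k * shifted_squares s k)" for s
  define Q where "Q s = (\<Prod>i=1..n. (2 * of_nat i - 1/2)^2 - s) / (fact (2 * n) :: rat)" for s
  define S :: rat where "S = (\<Sum>i=1..n. 1 / of_int (4 * int i - 1) ^ 2)"
  define G :: rat where "G = (pochhammer (1/2) m / fact m) ^ 2"
  let ?s = "of_nat p ^ 2 :: rat"
  have Q_sum: "Q s = (\<Sum>k\<le>n. terminating_coeff n k / fact (2 * n) * shifted_squares s k)" for s
    unfolding Q_def terminating_sum_product[symmetric] by (simp add: sum_divide_distrib)
  have s: "?s \<in> adic_ideal p 2" by (rule adic_idealI[of 1]) simp_all
  have inv: "1 / of_nat 4 \<in> localization_at p" "1 / of_nat 8 \<in> localization_at p"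
  proof -
    show "1 / of_nat 4 \<in> localization_at p"
      using assms(1) p prime_gt_1_nat[of p] by (intro localization_at_inverse_nat) auto
    then have "1 / of_nat 4 * (1 / of_nat 4) * 2 \<in> localization_at p"
      by (intro localization_at_closed) simp_all
    then show "1 / of_nat 8 \<in> localization_at p" by simp
  qed
  have t: "t \<in> adic_ideal p 2" using adic_ideal_scale[OF inv(1) s] by (simp add: t_def)
  note shifted = shifted_squares_cong[OF assms(1) \<open>odd p\<close>]
  have whipple_L: "whipple_coeff k \<in> localization_at p" if "k \<le> n" for k
  proof -
    have "pochhammer (1/2) k * (1 / fact k) ^ 3 \<in> localization_at p"
      using assms(1) \<open>odd p\<close> that pn
      by (intro localization_at_mult localization_at_power localization_at_inverse_fact
          pochhammer_half_in_localization) auto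
    then show ?thesis by (simp add: whipple_coeff_def power_divide)
  qed

  \<comment> \<open>\<open>F 0\<close> is the sum in question, and \<open>t = (n + 1/2)\<^sup>2\<close> makes \<open>F t\<close> a terminating
    series that is not cut off before its end.\<close>
  have F0: "(\<Sum>k=0..(p - 1) div 2. pochhammer (1/2) k ^ 3 / fact k ^ 3) = F 0"
    unfolding F_def half atLeast0AtMost
    by (intro sum.cong refl) (simp add: whipple_coeff_def shifted_squares_at_0 power2_eq_square power3_eq_cube)
  have F0_L: "F 0 \<in> localization_at p"
    unfolding F_def using whipple_L shifted(1)[OF zero_in_adic_ideal] by auto
  have "t = (2 * of_nat m + 1/2) ^ 2" unfolding t_def p by (simp add: power2_eq_square field_simps)
  then have Ft: "F t = G"
    unfolding F_def G_def lessThan_Suc_atMost[symmetric] by (simp only:) (rule whipple_sum_even, simp add: n_def)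

  \<comment> \<open>The coefficients of \<open>F\<close> and \<open>Q\<close> agree modulo \<open>p\<close> and the basis polynomials move by a multiple
    of \<open>p\<^sup>2\<close>, so the two increments agree modulo \<open>p\<^sup>3\<close>.\<close>
  have "(F t - F 0) - (Q t - Q 0)
      = (\<Sum>k\<le>n. (whipple_coeff k - terminating_coeff n k / fact (2 * n)) * (shifted_squares t k - shifted_squares 0 k))"
    unfolding F_def Q_sum by (simp only: sum_subtractf[symmetric] algebra_simps)
  also have "\<dots> \<in> adic_ideal p (1 + 2)"
    using assms(1) pn t shifted(2) whipple_coeff_cong by (intro adic_ideal_sum adic_ideal_mult) auto
  finally have 1: "(F t - F 0) - (Q t - Q 0) \<in> adic_ideal p 3" by (simp add: numeral_3_eq_3)

  have 2: "Q t - Q 0 * (1 - ?s * S) \<in> adic_ideal p 3"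
    using terminating_product_cong[OF assms(1) p n_def t_def] unfolding Q_def S_def .

  \<comment> \<open>The increment of \<open>Q\<close> already carries a factor \<open>p\<^sup>2\<close>, so \<open>Q 0\<close> may be replaced there by anything
    congruent to it modulo \<open>p\<close>, such as \<open>G = F t\<close>.\<close>
  have "F 0 - Q 0 = (\<Sum>k\<le>n. shifted_squares 0 k * (whipple_coeff k - terminating_coeff n k / fact (2 * n)))"
    unfolding F_def Q_sum by (simp only: sum_subtractf[symmetric] algebra_simps)
  also have "\<dots> \<in> adic_ideal p 1"
    using assms(1) pn shifted(1)[OF zero_in_adic_ideal] whipple_coeff_cong
    by (intro adic_ideal_sum adic_ideal_scale) auto
  finally have "F 0 - Q 0 \<in> adic_ideal p 1" .
  moreover have "F t - F 0 \<in> adic_ideal p 1"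
  proof -
    have "F t - F 0 = (\<Sum>k\<le>n. whipple_coeff k * (shifted_squares t k - shifted_squares 0 k))"
      unfolding F_def by (simp only: sum_subtractf[symmetric] algebra_simps)
    also have "\<dots> \<in> adic_ideal p 2"
      using whipple_L shifted(2)[OF t] by (intro adic_ideal_sum adic_ideal_scale) auto
    finally show ?thesis by (rule adic_ideal_antimono[rotated]) simp
  qed
  ultimately have GQ: "G - Q 0 \<in> adic_ideal p 1"
    using adic_ideal_add[of "F 0 - Q 0" p 1 "F t - F 0"] by (simp add: Ft)

  have S_L: "S \<in> localization_at p"
  proof -
    have "S = (\<Sum>i=1..n. (1 / of_int (4 * int i - 1)) ^ 2)" by (simp add: S_def power_divide)
    then show ?thesis
      using assms(1) not_dvd_four_i_minus_one[OF p]
      by (auto intro!: localization_at_sum localization_at_power localization_at_inverse_int simp: n_def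
          simp del: of_int_diff of_int_mult)
  qed
  have G_L: "G \<in> localization_at p"
  proof -
    have "(pochhammer (1/2) m * (1 / fact m)) ^ 2 \<in> localization_at p"
      using assms(1) \<open>odd p\<close> p
      by (intro localization_at_closed pochhammer_half_in_localization localization_at_inverse_fact) simp_all
    then show ?thesis by (simp add: G_def)
  qed
  have SH: "S + harmonic2 m / 8 \<in> adic_ideal p 1"
    unfolding S_def n_def by (rule inverse_square_sum_cong[OF assms(1) p])
  have 3: "?s * (S * (G - Q 0)) \<in> adic_ideal p 3"
    using adic_ideal_mult[OF s adic_ideal_scale[OF S_L GQ]] by (simp add: numeral_3_eq_3)
  have 4: "?s * (G * (S + harmonic2 m / 8)) \<in> adic_ideal p 3"
    using adic_ideal_mult[OF s adic_ideal_scale[OF G_L SH]] by (simp add: numeral_3_eq_3)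

  have "F 0 - G * (1 - ?s / 8 * harmonic2 m)
      = - ((F t - F 0) - (Q t - Q 0)) - (Q t - Q 0 * (1 - ?s * S))
        - ?s * (S * (G - Q 0)) + ?s * (G * (S + harmonic2 m / 8))"
    unfolding Ft by (simp add: algebra_simps)
  also have "\<dots> \<in> adic_ideal p 3"
    by (rule adic_ideal_add[OF adic_ideal_diff[OF adic_ideal_diff[OF adic_ideal_uminus[OF 1] 2] 3] 4])
  finally have diff: "F 0 - G * (1 - ?s / 8 * harmonic2 m) \<in> adic_ideal p 3" .
  have "F 0 - (F 0 - G * (1 - ?s / 8 * harmonic2 m)) \<in> localization_at p"
    using F0_L adic_ideal_in_localization[OF diff] by (rule localization_at_diff)
  then have "G * (1 - ?s / 8 * harmonic2 m) \<in> localization_at p" by simp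
  with F0_L diff have "local_cong p (F 0) (G * (1 - ?s / 8 * harmonic2 m)) (p ^ 3)"
    unfolding local_cong_def adic_ideal_def by auto
  then show ?thesis unfolding F0 m_def[symmetric] by (simp add: G_def power_divide)
qed

end
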